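(* Let $G$ be a primitive subgroup of the symmetric group $S_n$ containing an odd permutation, and let $\vartheta\colon\mathbb{N}\to\mathbb{N}$ be the function given by $\vartheta(n)=n+1$ if $n=2k+1$ is odd and $\vartheta(n)=n$ if $n=2k$ is even. Then the inequality $\gamma(G)\leq\vartheta(n)$ holds.
   Context: For a group $G$, $V(G)$ denotes the set of all proper non-trivial subgroups of $G$. The intersection graph $\Gamma(G)$ is the simple undirected graph with vertex set $V(G)$ in which two distinct vertices $H,K$ are adjacent if and only if $H\cap K\neq 1$, where $1$ denotes the trivial subgroup. A dominating set of a graph is a subset $D$ of its vertex set such that every vertex not in $D$ is adjacent to some vertex in $D$. The domination number $\gamma(G)$ is the smallest cardinality of a dominating set of $\Gamma(G)$; by convention $\gamma(G)=\aleph_0$ when $V(G)$ is empty (that is, when $G$ is trivial or cyclic of prime order). $S_n$ is the group of all permutations of $\{1,\dots,n\}$. A subgroup of $S_n$ is primitive if it is transitive on $\{1,\dots,n\}$ and preserves no partition of $\{1,\dots,n\}$ other than the partition into singletons and the partition with a single block.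
   Formalization: The case n = 2 is excluded: there G = S_2 is primitive and contains an odd permutation, but V(G) is empty, so by the stated convention γ(G) = ℵ₀ and the inequality γ(G) ≤ ϑ(2) = 2 fails. *)

theory Defs
  imports "HOL-Algebra.Sym_Groups" "HOL-Library.Disjoint_Sets" "HOL-Library.Extended_Nat"
begin

section \<open>Domination in graphs\<close>

text \<open>
  A simple graph is given by its vertex set \<open>V\<close> and its (symmetric, irreflexive) adjacency
  relation. Cardinalities are measured in \<^typ>\<open>enat\<close>: all infinite cardinals are identified
  with \<open>\<infinity>\<close>. Every graph has a dominating set (\<open>V\<close> itself), so the infimum below is attained.
\<close>

definition dominating_set :: "'v set \<Rightarrow> ('v \<Rightarrow> 'v \<Rightarrow> bool) \<Rightarrow> 'v set \<Rightarrow> bool" where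
  "dominating_set V adj D \<longleftrightarrow> D \<subseteq> V \<and> (\<forall>v\<in>V - D. \<exists>d\<in>D. adj v d)"

definition graph_domination_number :: "'v set \<Rightarrow> ('v \<Rightarrow> 'v \<Rightarrow> bool) \<Rightarrow> enat" where
  "graph_domination_number V adj =
     (INF D\<in>{D. dominating_set V adj D}. if finite D then enat (card D) else \<infinity>)"


section \<open>The intersection graph of a group\<close>

definition proper_nontrivial_subgroups :: "('a, 'b) monoid_scheme \<Rightarrow> 'a set set" where
  "proper_nontrivial_subgroups G =
     {H. subgroup H G \<and> H \<noteq> carrier G \<and> H \<noteq> {\<one>\<^bsub>G\<^esub>}}"

definition intersection_adj :: "('a, 'b) monoid_scheme \<Rightarrow> 'a set \<Rightarrow> 'a set \<Rightarrow> bool" where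
  "intersection_adj G H K \<longleftrightarrow>
     H \<in> proper_nontrivial_subgroups G \<and> K \<in> proper_nontrivial_subgroups G \<and>
     H \<noteq> K \<and> H \<inter> K \<noteq> {\<one>\<^bsub>G\<^esub>}"

text \<open>
  The value \<open>\<infinity>\<close> for a group without proper non-trivial subgroups is the convention
  \<open>\<gamma>(G) = \<aleph>\<^sub>0\<close>; without it the empty dominating set would give \<open>0\<close>.
\<close>

definition domination_number :: "('a, 'b) monoid_scheme \<Rightarrow> enat" where
  "domination_number G =
     (if proper_nontrivial_subgroups G = {} then \<infinity>
      else graph_domination_number (proper_nontrivial_subgroups G) (intersection_adj G))"


section \<open>Primitive permutation groups\<close>

definition transitive_on :: "('a \<Rightarrow> 'a) set \<Rightarrow> 'a set \<Rightarrow> bool" where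
  "transitive_on G S \<longleftrightarrow> (\<forall>x\<in>S. \<forall>y\<in>S. \<exists>g\<in>G. g x = y)"

definition preserves_partition :: "('a \<Rightarrow> 'a) set \<Rightarrow> 'a set set \<Rightarrow> bool" where
  "preserves_partition G P \<longleftrightarrow> (\<forall>g\<in>G. \<forall>B\<in>P. g ` B \<in> P)"

definition primitive_on :: "('a \<Rightarrow> 'a) set \<Rightarrow> 'a set \<Rightarrow> bool" where
  "primitive_on G S \<longleftrightarrow>
     transitive_on G S \<and>
     (\<forall>P. partition_on S P \<and> preserves_partition G P \<longrightarrow> P = (\<lambda>x. {x}) ` S \<or> P = {S})"

definition theta :: "nat \<Rightarrow> nat" where
  "theta n = (if odd n then n + 1 else n)"

end

theory Submission
  imports Defs
begin

text \<open>
  The bound comes from one explicit family of subgroups: the even permutations \<open>A\<close> of \<open>G\<close>,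
  together with setwise stabilisers in \<open>G\<close> of the sets \<open>{1, j}\<close>. Let \<open>H\<close> be a non-trivial
  subgroup. Either \<open>H\<close> contains an even permutation other than the identity, and then \<open>H\<close>
  meets \<open>A\<close>; or every \<open>h \<noteq> id\<close> in \<open>H\<close> is odd, so that the even permutation \<open>h \<circ> h\<close> has to be
  the identity. In the second case \<open>h\<close> is an involution, hence it stabilises \<open>{1, h 1}\<close>.

  Letting \<open>j\<close> run over all points gives \<open>n + 1\<close> subgroups. If \<open>n\<close> is even then \<open>j = 1\<close> can be
  left out, which saves one subgroup: an involution has as many fixed points modulo \<open>2\<close> as there
  are points (\<open>even_card_fixpoints\<close>), so one that fixes \<open>1\<close> also fixes some \<open>j \<noteq> 1\<close>, and it
  stabilises \<open>{1, j}\<close>.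

  All these subgroups are proper: \<open>A\<close> because \<open>G\<close> contains an odd permutation, the stabilisers
  because \<open>G\<close> is transitive on at least three points. Those that happen to be trivial can simply
  be dropped (\<open>domination_number_le_card\<close>), provided that \<open>G\<close> has some proper non-trivial
  subgroup at all. The subgroup \<open>A\<close> is one: otherwise \<open>G\<close> would have order two and could
  not be transitive on three points.
\<close>

section \<open>Bounding the domination number\<close>

text \<open>
  A trivial member of the family meets no subgroup non-trivially, so removing it leaves a
  dominating set. The family may therefore contain the trivial subgroup.
\<close>

lemma domination_number_le_card:
  assumes "finite F"
    and proper: "\<And>K. K \<in> F \<Longrightarrow> subgroup K G \<and> K \<noteq> carrier G"
    and meets: "\<And>H. subgroup H G \<Longrightarrow> H \<noteq> {\<one>\<^bsub>G\<^esub>} \<Longrightarrow> \<exists>K\<in>F. H \<inter> K \<noteq> {\<one>\<^bsub>G\<^esub>}"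
    and ex: "proper_nontrivial_subgroups G \<noteq> {}"
  shows "domination_number G \<le> enat (card F)"
proof -
  let ?V = "proper_nontrivial_subgroups G"
  define D where "D = F - {{\<one>\<^bsub>G\<^esub>}}"
  have DV: "D \<subseteq> ?V"
    using proper by (auto simp: D_def proper_nontrivial_subgroups_def)
  have "\<exists>K\<in>D. intersection_adj G H K" if H: "H \<in> ?V - D" for H
  proof -
    have sub: "subgroup H G" and "H \<noteq> {\<one>\<^bsub>G\<^esub>}"
      using H by (auto simp: proper_nontrivial_subgroups_def)
    then obtain K where K: "K \<in> F" "H \<inter> K \<noteq> {\<one>\<^bsub>G\<^esub>}"
      using meets by blast
    have "K \<noteq> {\<one>\<^bsub>G\<^esub>}"
      using K(2) subgroup.one_closed[OF sub] by auto
    then have "K \<in> D"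
      using K(1) by (simp add: D_def)
    then show ?thesis
      using H K(2) DV by (auto simp: intersection_adj_def)
  qed
  then have "dominating_set ?V (intersection_adj G) D"
    using DV by (simp add: dominating_set_def)
  then have "graph_domination_number ?V (intersection_adj G) \<le> (if finite D then enat (card D) else \<infinity>)"
    unfolding graph_domination_number_def by (intro INF_lower) simp
  also have "\<dots> \<le> enat (card F)"
    using \<open>finite F\<close> by (simp add: D_def card_mono)
  finally show ?thesis
    using ex by (simp add: domination_number_def)
qed


section \<open>Fixed points of involutions\<close>

text \<open>
  The points that are not fixed split into those moved up and those moved down, and the
  involution exchanges these two sets.
\<close>

lemma even_card_fixpoints:
  fixes f :: "'a::linorder \<Rightarrow> 'a"
  assumes "finite S" and maps: "\<And>x. x \<in> S \<Longrightarrow> f x \<in> S" and inv: "\<And>x. x \<in> S \<Longrightarrow> f (f x) = x"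
  shows "even (card {x \<in> S. f x = x}) \<longleftrightarrow> even (card S)"
proof -
  let ?F = "{x \<in> S. f x = x}" and ?U = "{x \<in> S. x < f x}" and ?L = "{x \<in> S. f x < x}"
  have "bij_betw f ?U ?L"
    by (rule bij_betwI[where g = f]) (auto simp: maps inv)
  then have "card ?U = card ?L"
    by (rule bij_betw_same_card)
  moreover have "card S = card ?F + card ?U + card ?L"
  proof -
    have "S = (?F \<union> ?U) \<union> ?L"
      by auto
    moreover have "card ((?F \<union> ?U) \<union> ?L) = card (?F \<union> ?U) + card ?L"
      by (rule card_Un_disjoint) (use \<open>finite S\<close> in auto)
    moreover have "card (?F \<union> ?U) = card ?F + card ?U"
      by (rule card_Un_disjoint) (use \<open>finite S\<close> in auto)
    ultimately show ?thesis
      by simp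
  qed
  ultimately have "card S = card ?F + 2 * card ?U"
    by simp
  then show ?thesis
    by presburger
qed

lemma involution_second_fixpoint:
  fixes f :: "'a::linorder \<Rightarrow> 'a"
  assumes "finite S" "even (card S)" "a \<in> S" "f a = a"
    and "\<And>x. x \<in> S \<Longrightarrow> f x \<in> S" "\<And>x. x \<in> S \<Longrightarrow> f (f x) = x"
  obtains b where "b \<in> S" "b \<noteq> a" "f b = b"
proof (rule ccontr)
  assume "\<not> thesis"
  then have "{x \<in> S. f x = x} = {a}"
    using that assms(3,4) by auto
  then show False
    using even_card_fixpoints[of S f] assms by simp
qed


section \<open>Setwise stabilisers and even permutations\<close>

lemma sym_group_stabiliser:
  "subgroup {p \<in> carrier (sym_group n). p ` X = X} (sym_group n)"
proof (rule group.subgroupI[OF sym_group_is_group])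
  show "{p \<in> carrier (sym_group n). p ` X = X} \<noteq> {}"
    using permutes_id[of "{1..n}"] by (auto simp: sym_group_def intro!: exI[of _ id])
next
  fix p assume p: "p \<in> {p \<in> carrier (sym_group n). p ` X = X}"
  then have "inv' p ` X = X"
    by (metis (mono_tags, lifting) image_inv_f_f mem_Collect_eq permutes_inj sym_group_carrier)
  with p show "inv\<^bsub>sym_group n\<^esub> p \<in> {p \<in> carrier (sym_group n). p ` X = X}"
    using sym_group_inv_equality sym_group_inv_closed by simp
next
  fix p q
  assume "p \<in> {p \<in> carrier (sym_group n). p ` X = X}" "q \<in> {p \<in> carrier (sym_group n). p ` X = X}"
  then show "p \<otimes>\<^bsub>sym_group n\<^esub> q \<in> {p \<in> carrier (sym_group n). p ` X = X}"
    by (auto simp: sym_group_def permutes_compose simp flip: image_image)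
qed auto

context
  fixes n :: nat and G :: "(nat \<Rightarrow> nat) set"
  assumes sub: "subgroup G (sym_group n)"
begin

lemma elem_permutes: "g \<in> G \<Longrightarrow> g permutes {1..n}"
  using subgroup.subset[OF sub] by (auto simp: sym_group_def)

lemma comp_mem: "g \<in> G \<Longrightarrow> h \<in> G \<Longrightarrow> g \<circ> h \<in> G"
  using subgroup.m_closed[OF sub] by (auto simp: sym_group_def)

lemma evenperm_comp_iff:
  "g \<in> G \<Longrightarrow> h \<in> G \<Longrightarrow> evenperm (g \<circ> h) \<longleftrightarrow> (evenperm g \<longleftrightarrow> evenperm h)"
  by (intro evenperm_comp permutation_permutes[THEN iffD2] exI[of _ "{1..n}"] conjI elem_permutes) auto

lemma subgroup_Int_sym_group:
  assumes "subgroup K (sym_group n)"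
  shows "subgroup (G \<inter> K) (sym_group n\<lparr>carrier := G\<rparr>)"
  using group.subgroup_incl[OF sym_group_is_group group.subgroups_Inter_pair[OF sym_group_is_group sub assms] sub] by auto

lemma subgroup_stabiliser: "subgroup {g \<in> G. g ` X = X} (sym_group n\<lparr>carrier := G\<rparr>)"
proof -
  have "{g \<in> G. g ` X = X} = G \<inter> {p \<in> carrier (sym_group n). p ` X = X}"
    using subgroup.subset[OF sub] by auto
  then show ?thesis
    using subgroup_Int_sym_group[OF sym_group_stabiliser] by simp
qed

lemma subgroup_evenperm: "subgroup {g \<in> G. evenperm g} (sym_group n\<lparr>carrier := G\<rparr>)"
proof -
  have "{g \<in> G. evenperm g} = G \<inter> carrier (alt_group n)"
    using elem_permutes by (auto simp: alt_group_def)
  then show ?thesis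
    using subgroup_Int_sym_group[OF group_hom.subgroup_kernel[OF sign_group_hom[of n], folded alt_group_is_sign_kernel]] by simp
qed

lemma stabiliser_proper:
  assumes "transitive_on G S" "x \<in> X" "x \<in> S" "y \<in> S" "y \<notin> X"
  shows "{g \<in> G. g ` X = X} \<noteq> G"
proof -
  obtain g where "g \<in> G" "g x = y"
    using assms by (auto simp: transitive_on_def)
  then have "g \<notin> {g \<in> G. g ` X = X}"
    using assms by auto
  then show ?thesis
    using \<open>g \<in> G\<close> by blast
qed

text \<open>
  If only the identity were even, then any two odd elements \<open>g\<close>, \<open>h\<close> would satisfy
  \<open>g \<circ> h = id = g \<circ> g\<close> and hence coincide. So \<open>G\<close> would have at most two elements, and the
  orbit of \<open>1\<close> at most two points.
\<close>

lemma even_part_nontrivial: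
  assumes trans: "transitive_on G {1..n}" and "3 \<le> n"
  shows "{g \<in> G. evenperm g} \<noteq> {id}"
proof
  assume triv: "{g \<in> G. evenperm g} = {id}"
  obtain g where g: "g \<in> G" "g 1 = 2"
    using trans \<open>3 \<le> n\<close> by (fastforce simp: transitive_on_def)
  obtain h where h: "h \<in> G" "h 1 = 3"
    using trans \<open>3 \<le> n\<close> by (fastforce simp: transitive_on_def)
  have "\<not> evenperm g" "\<not> evenperm h"
  proof -
    have "g \<noteq> id" "h \<noteq> id"
      using g(2) h(2) by auto
    then show "\<not> evenperm g" "\<not> evenperm h"
      using g(1) h(1) triv by blast+
  qed
  then have "evenperm (g \<circ> g)" "evenperm (g \<circ> h)"
    using g h by (simp_all add: evenperm_comp_iff)
  then have "g \<circ> g = id" "g \<circ> h = id"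
    using comp_mem[OF g(1) g(1)] comp_mem[OF g(1) h(1)] triv by blast+
  then have "g (g 1) = g (h 1)"
    by (metis comp_apply)
  then have "g 1 = h 1"
    using permutes_inj[OF elem_permutes[OF g(1)]] by (simp add: inj_eq)
  then show False
    using g h by simp
qed

text \<open>
  If no \<open>h \<noteq> id\<close> in \<open>H\<close> is even, then \<open>h \<circ> h\<close>, being even, is the identity, so \<open>h\<close> stabilises
  \<open>{1, h 1}\<close> and \<open>j = h 1\<close> serves for odd \<open>n\<close>. For even \<open>n\<close> the witness \<open>j\<close> is \<open>h 1\<close>, or a second fixed point of \<open>h\<close>
  if \<open>h\<close> fixes \<open>1\<close>.
\<close>

lemma even_or_stabilises_pair:
  assumes H: "subgroup H (sym_group n\<lparr>carrier := G\<rparr>)" "H \<noteq> {id}" and "1 \<le> n"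
  obtains h where "h \<in> H" "h \<noteq> id" "evenperm h"
  | h j where "h \<in> H" "h \<noteq> id" "j \<in> {1..n}" "even n \<Longrightarrow> j \<noteq> 1" "h ` {1, j} = {1, j}"
proof (cases "\<exists>h\<in>H. h \<noteq> id \<and> evenperm h")
  case True
  then show ?thesis
    using that(1) by blast
next
  case False
  have HG: "H \<subseteq> G"
    using subgroup.subset[OF H(1)] by simp
  have "id \<in> H"
    using subgroup.one_closed[OF H(1)] by (simp add: sym_group_def)
  then obtain h where h: "h \<in> H" "h \<noteq> id"
    using H(2) by blast
  then have "h \<in> G"
    using HG by blast
  have "h \<circ> h \<in> H"
    using subgroup.m_closed[OF H(1) h(1) h(1)] by (simp add: sym_group_def)
  moreover have "evenperm (h \<circ> h)"
    using \<open>h \<in> G\<close> by (simp add: evenperm_comp_iff)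
  ultimately have "h \<circ> h = id"
    using False by blast
  then have invol: "h (h x) = x" for x
    by (metis comp_apply id_apply)
  have maps: "h x \<in> {1..n}" if "x \<in> {1..n}" for x
    using permutes_in_image[OF elem_permutes[OF \<open>h \<in> G\<close>]] that by blast
  show ?thesis
  proof (cases "even n \<and> h 1 = 1")
    case True
    then obtain j where "j \<in> {1..n}" "j \<noteq> 1" "h j = j"
      using involution_second_fixpoint[of "{1..n}" 1 h] maps invol \<open>1 \<le> n\<close> by auto
    then show ?thesis
      using that(2)[OF h, of j] True by simp
  next
    case False
    then show ?thesis
      using that(2)[OF h, of "h 1"] maps[of 1] invol[of 1] \<open>1 \<le> n\<close> by auto
  qed
qed

end


section \<open>The bound\<close>

theorem corollary5p3:
  fixes n :: nat and G :: "(nat \<Rightarrow> nat) set"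
  assumes "subgroup G (sym_group n)"
    and "primitive_on G {1..n}"
    and "\<exists>\<sigma>\<in>G. \<not> evenperm \<sigma>"
    and "n \<noteq> 2"
  shows "domination_number (sym_group n\<lparr>carrier := G\<rparr>) \<le> enat (theta n)"
proof -
  let ?G = "sym_group n\<lparr>carrier := G\<rparr>"
  note sub = assms(1)
  have trans: "transitive_on G {1..n}"
    using assms(2) by (simp add: primitive_on_def)
  obtain \<sigma> where \<sigma>: "\<sigma> \<in> G" "\<not> evenperm \<sigma>"
    using assms(3) by blast
  \<comment> \<open>On fewer than two points the identity is the only permutation, and it is even.\<close>
  have "2 \<le> n"
  proof (rule ccontr)
    assume "\<not> 2 \<le> n"
    then have "{1..n} \<subseteq> {1}"
      by auto
    then have "\<sigma> permutes {1}"
      using elem_permutes[OF sub \<sigma>(1)] permutes_subset by blast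
    then show False
      using \<sigma>(2) by (simp add: permutes_sing evenperm_id)
  qed
  with assms(4) have n: "3 \<le> n"
    by simp
  have one: "\<one>\<^bsub>?G\<^esub> = id"
    by (simp add: sym_group_def)
  define A where "A = {g \<in> G. evenperm g}"
  define stab where "stab j = {g \<in> G. g ` {1, j} = {1, j}}" for j
  define J where "J = (if even n then {2..n} else {1..n})"
  define F where "F = insert A (stab ` J)"
  have "finite F"
    by (simp add: F_def J_def)
  have A: "subgroup A ?G" "A \<noteq> G" "A \<noteq> {id}"
    using subgroup_evenperm[OF sub] even_part_nontrivial[OF sub trans n] \<sigma> by (auto simp: A_def)
  have "domination_number ?G \<le> enat (card F)"
  proof (rule domination_number_le_card[OF \<open>finite F\<close>])
    fix K assume "K \<in> F"
    then consider "K = A" | j where "K = stab j"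
      by (auto simp: F_def)
    then show "subgroup K ?G \<and> K \<noteq> carrier ?G"
    proof cases
      case 2
      have "(if j = 2 then 3 else 2) \<in> {1..n}" "(if j = 2 then 3 else 2) \<notin> {1, j}"
        using n by auto
      then have "stab j \<noteq> G"
        unfolding stab_def using n by (intro stabiliser_proper[OF sub trans, of 1]) auto
      then show ?thesis
        using subgroup_stabiliser[OF sub, of "{1, j}"] 2 by (simp add: stab_def)
    qed (use A in simp)
  next
    fix H assume H: "subgroup H ?G" "H \<noteq> {\<one>\<^bsub>?G\<^esub>}"
    have HG: "H \<subseteq> G"
      using subgroup.subset[OF H(1)] by simp
    have "H \<noteq> {id}"
      using H(2) one by simp
    moreover have "1 \<le> n"
      using n by simp
    ultimately show "\<exists>K\<in>F. H \<inter> K \<noteq> {\<one>\<^bsub>?G\<^esub>}"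
      unfolding one
    proof (rule even_or_stabilises_pair[OF sub H(1)])
      fix h assume h: "h \<in> H" "h \<noteq> id" "evenperm h"
      then have "h \<in> H \<inter> A"
        using HG by (auto simp: A_def)
      then show "\<exists>K\<in>F. H \<inter> K \<noteq> {id}"
        using h(2) by (auto simp: F_def)
    next
      fix h j
      assume h: "h \<in> H" "h \<noteq> id" "h ` {1, j} = {1, j}"
        and j: "j \<in> {1..n}" "even n \<Longrightarrow> j \<noteq> 1"
      then have "h \<in> H \<inter> stab j"
        using HG by (auto simp: stab_def)
      moreover have "j \<in> J"
        using j by (auto simp: J_def)
      ultimately show "\<exists>K\<in>F. H \<inter> K \<noteq> {id}"
        using h(2) by (auto simp: F_def)
    qed
  next
    show "proper_nontrivial_subgroups ?G \<noteq> {}"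
      using A one by (auto simp: proper_nontrivial_subgroups_def)
  qed
  also have "card F \<le> theta n"
  proof -
    have "card F \<le> Suc (card (stab ` J))"
      unfolding F_def by (rule card_insert_le_m1) simp_all
    also have "\<dots> \<le> Suc (card J)"
      by (simp add: J_def card_image_le)
    also have "\<dots> = theta n"
      using n by (auto simp: J_def theta_def)
    finally show ?thesis .
  qed
  finally show ?thesis
    by simp
qed

end
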